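(* Let $G_1$ and $G_2$ be vertex-disjoint finite connected graphs with distance matrices $D_1,D_2$ such that neither linear system $D_1x=\mathbf{1}$ nor $D_2x=\mathbf{1}$ has a solution. Let $u\in V(G_1)$, $v\in V(G_2)$, and let $H$ be obtained by adding the edge $\{u,v\}$ between $G_1$ and $G_2$ and then contracting this edge (i.e. identifying $u$ and $v$). If $D_H$ is the distance matrix of $H$, then the linear system $D_Hx=\mathbf{1}$ has no solution.
   Context: For a finite connected graph with vertices $v_1,\dots,v_m$, the distance matrix is $D_{ij}=d(v_i,v_j)$ (shortest-path distance), and $\mathbf{1}$ denotes the all-ones vector of the appropriate size. *)

theory Defs
  imports "Graph_Theory.Graph_Theory" "Jordan_Normal_Form.Matrix"
begin

text \<open>
  A finite simple undirected graph is a \<open>pair_graph\<close>: finite, loop-free, and with a symmetric set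
  of arcs, so that an edge \<open>{a, b}\<close> is the pair of arcs \<open>(a, b)\<close> and \<open>(b, a)\<close>.
\<close>

text \<open>
  \<open>wf_digraph.\<mu>\<close> is the infimum in \<open>ereal\<close> of the costs of all walks. With unit arc costs the cost
  of a walk is its length, so in a connected graph the infimum is a finite minimum and
  \<open>real_of_ereal\<close> loses nothing.
\<close>

definition graph_dist :: "'a pair_pre_digraph \<Rightarrow> 'a \<Rightarrow> 'a \<Rightarrow> real" where
  "graph_dist G a b = real_of_ereal (wf_digraph.\<mu> (with_proj G) (\<lambda>_. 1) a b)"

text \<open>The list \<open>vs\<close> is the numbering of the vertices that indexes rows and columns.\<close>

definition distance_matrix :: "'a pair_pre_digraph \<Rightarrow> 'a list \<Rightarrow> real mat" where
  "distance_matrix G vs =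
     mat (length vs) (length vs) (\<lambda>(i, j). graph_dist G (vs ! i) (vs ! j))"

definition all_ones_vec :: "nat \<Rightarrow> real vec" where
  "all_ones_vec n = vec n (\<lambda>_. 1)"

definition has_solution :: "real mat \<Rightarrow> real vec \<Rightarrow> bool" where
  "has_solution A b \<longleftrightarrow> (\<exists>x \<in> carrier_vec (dim_col A). A *\<^sub>v x = b)"

definition graph_union ::
    "'a pair_pre_digraph \<Rightarrow> 'a pair_pre_digraph \<Rightarrow> 'a pair_pre_digraph" where
  "graph_union G1 G2 = \<lparr>pverts = pverts G1 \<union> pverts G2, parcs = parcs G1 \<union> parcs G2\<rparr>"

definition add_edge :: "'a \<Rightarrow> 'a \<Rightarrow> 'a pair_pre_digraph \<Rightarrow> 'a pair_pre_digraph" where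
  "add_edge u v G = \<lparr>pverts = pverts G, parcs = parcs G \<union> {(u, v), (v, u)}\<rparr>"

text \<open>
  Contraction of the edge \<open>{u, v}\<close>: the merged vertex keeps the name \<open>u\<close>. The side condition
  \<open>m a \<noteq> m b\<close> deletes the contracted edge itself, which would otherwise become a loop.
\<close>

definition contract_edge :: "'a \<Rightarrow> 'a \<Rightarrow> 'a pair_pre_digraph \<Rightarrow> 'a pair_pre_digraph" where
  "contract_edge u v G =
     (let m = (\<lambda>a. if a = v then u else a)
      in \<lparr>pverts = m ` pverts G, parcs = {(m a, m b) |a b. (a, b) \<in> parcs G \<and> m a \<noteq> m b}\<rparr>)"

end

theory Submission
  imports Defs
begin

text \<open>
  A symmetric system \<open>D x = \<one>\<close> is unsolvable iff some \<open>z\<close> satisfies \<open>D z = 0\<close> and \<open>\<one>\<^sup>T z = 1\<close>.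
  Retracting \<open>H\<close> onto either part by collapsing the other part to the merged vertex, the distance
  in \<open>H\<close> is the sum of the distances of the two projections. Hence, for such kernel vectors \<open>z1\<close> of
  \<open>D1\<close> and \<open>z2\<close> of \<open>D2\<close>, extended by zero and with \<open>v\<close> renamed to \<open>u\<close>, the vector \<open>z1 + z2 - e\<^sub>u\<close>
  is again in the kernel of the distance matrix of \<open>H\<close>, and its entries sum to \<open>1 + 1 - 1 = 1\<close>.
\<close>

section \<open>Distances\<close>

context pair_wf_digraph
begin

text \<open>Relational powers let walk lengths be handled by induction on the exponent. The
  assumption on \<open>a\<close> matters at exponent 0: the empty walk must start in the graph,
  while the zeroth power is the identity on the whole type.\<close>

lemma awalk_relpow_iff:
  assumes "a \<in> pverts G"
  shows "(\<exists>p. awalk a p b \<and> length p = n) \<longleftrightarrow> (a, b) \<in> parcs G ^^ n"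
  using assms
proof (induction n arbitrary: a)
  case 0
  then show ?case by (auto simp: awalk_Nil_iff)
next
  case (Suc n)
  have "(\<exists>p. awalk a p b \<and> length p = Suc n) \<longleftrightarrow>
      (\<exists>e q. awalk a (e # q) b \<and> length q = n)"
    by (metis length_Suc_conv)
  also have "\<dots> \<longleftrightarrow>
      (\<exists>c. (a, c) \<in> parcs G \<and> (\<exists>p. awalk c p b \<and> length p = n))"
    by (auto simp: awalk_Cons_iff)
  also have "\<dots> \<longleftrightarrow> (a, b) \<in> parcs G ^^ Suc n"
    using Suc.IH in_arcsD2 by (metis relpow_Suc_D2 relpow_Suc_I2)
  finally show ?case .
qed

text \<open>Unit costs make the cost of a walk its length, so a least exponent is an attained
  infimum. From here on \<open>\<mu>\<close> is no longer unfolded.\<close>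

lemma graph_dist_eqI:
  assumes "a \<in> pverts G" and "(a, b) \<in> parcs G ^^ n"
    and "\<And>k. (a, b) \<in> parcs G ^^ k \<Longrightarrow> n \<le> k"
  shows "graph_dist G a b = real n"
proof -
  have cost: "awalk_cost (\<lambda>_. 1) p = real (length p)" for p :: "('a \<times> 'a) list"
    by (induction p) auto
  have "\<mu> (\<lambda>_. 1) a b = ereal (real n)"
    unfolding \<mu>_def
  proof (rule INF_eqI)
    fix p assume "p \<in> {p. awalk a p b}"
    then show "ereal (real n) \<le> ereal (awalk_cost (\<lambda>_. 1) p)"
      using assms(3)[of "length p"] awalk_relpow_iff[OF assms(1), of b] by (auto simp: cost)
  next
    fix y assume y: "\<And>p. p \<in> {p. awalk a p b} \<Longrightarrow> y \<le> ereal (awalk_cost (\<lambda>_. 1) p)"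
    obtain p where "awalk a p b" "length p = n"
      using awalk_relpow_iff[OF assms(1)] assms(2) by blast
    then show "y \<le> ereal (real n)"
      using y[of p] by (simp add: cost)
  qed
  then show ?thesis
    by (simp add: graph_dist_def)
qed

end

locale connected_pair_graph = pair_graph +
  assumes connected: "Digraph_Component.connected (with_proj G)"
begin

lemma relpow_ex: "\<exists>n. (a, b) \<in> parcs G ^^ n" if "a \<in> pverts G" "b \<in> pverts G"
proof -
  \<comment> \<open>Connectedness ignores arc directions; the symmetry of the arcs turns it into
    directed reachability.\<close>
  have "strongly_connected (with_proj G)"
    using connected sym_arcs by (intro symmetric_connected_imp_strongly_connected) auto
  then have "reachable (with_proj G) a b"
    using that by (auto simp: strongly_connected_def)
  then show ?thesis
    using awalk_relpow_iff[OF that(1), of b] by (auto simp: reachable_awalk)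
qed

lemma graph_dist_attained:
  assumes "a \<in> pverts G" "b \<in> pverts G"
  obtains n where "(a, b) \<in> parcs G ^^ n" "graph_dist G a b = real n"
    "\<And>k. (a, b) \<in> parcs G ^^ k \<Longrightarrow> n \<le> k"
proof -
  let ?n = "LEAST n. (a, b) \<in> parcs G ^^ n"
  have n: "(a, b) \<in> parcs G ^^ ?n"
    using relpow_ex[OF assms] by (rule LeastI_ex)
  have le: "?n \<le> k" if "(a, b) \<in> parcs G ^^ k" for k
    using that by (rule Least_le)
  show thesis
    using that[OF n graph_dist_eqI[OF assms(1) n le] le] by blast
qed

lemma graph_dist_self [simp]: "a \<in> pverts G \<Longrightarrow> graph_dist G a a = 0"
  using graph_dist_eqI[of a a 0] by simp

text \<open>A shortest walk to \<open>b\<close> extends by one arc. This instance of the triangle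
  inequality feeds the lower bound for distances in \<open>H\<close>.\<close>

lemma graph_dist_step:
  assumes "a \<in> pverts G" "(b, c) \<in> parcs G"
  shows "graph_dist G a c \<le> graph_dist G a b + 1"
proof -
  obtain n where n: "(a, b) \<in> parcs G ^^ n" "graph_dist G a b = real n"
    using graph_dist_attained assms in_arcsD1 by metis
  obtain k where k: "graph_dist G a c = real k" "\<And>j. (a, c) \<in> parcs G ^^ j \<Longrightarrow> k \<le> j"
    using graph_dist_attained assms in_arcsD2 by metis
  have "(a, c) \<in> parcs G ^^ Suc n"
    using n(1) assms(2) by auto
  then show ?thesis
    using k n(2) by fastforce
qed

lemma relpow_sym: "(a, b) \<in> parcs G ^^ n \<Longrightarrow> (b, a) \<in> parcs G ^^ n"
proof (induction n arbitrary: b)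
  case (Suc n)
  then obtain c where "(a, c) \<in> parcs G ^^ n" "(c, b) \<in> parcs G" by auto
  then show ?case
    using Suc.IH arcs_symmetric by (metis relpow_Suc_I2)
qed auto

lemma graph_dist_sym:
  assumes "a \<in> pverts G" "b \<in> pverts G"
  shows "graph_dist G a b = graph_dist G b a"
proof -
  obtain n where n: "(a, b) \<in> parcs G ^^ n" "graph_dist G a b = real n"
    "\<And>k. (a, b) \<in> parcs G ^^ k \<Longrightarrow> n \<le> k"
    using graph_dist_attained assms by metis
  have "graph_dist G b a = real n"
    using n assms by (intro graph_dist_eqI) (auto dest: relpow_sym)
  then show ?thesis using n by simp
qed

end

section \<open>Coalescence of two graphs at a vertex\<close>

locale coalescence =
  G1: connected_pair_graph G1 + G2: connected_pair_graph G2
  for G1 G2 :: "'a pair_pre_digraph" +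
  fixes u v :: 'a and H :: "'a pair_pre_digraph"
  assumes disjoint: "pverts G1 \<inter> pverts G2 = {}"
    and u: "u \<in> pverts G1" and v: "v \<in> pverts G2"
    and H: "H = contract_edge u v (add_edge u v (graph_union G1 G2))"
begin

definition merge :: "'a \<Rightarrow> 'a" where "merge a = (if a = v then u else a)"

text \<open>The two retractions of \<open>H\<close> onto its parts. The merged vertex is called
  \<open>u\<close> and lies in \<open>pverts G1\<close>, so \<open>retr2\<close> restores its old
  name \<open>v\<close>.\<close>

definition retr1 :: "'a \<Rightarrow> 'a" where "retr1 a = (if a \<in> pverts G1 then a else u)"
definition retr2 :: "'a \<Rightarrow> 'a" where "retr2 a = (if a \<in> pverts G1 then v else a)"

lemma pverts_H: "pverts H = pverts G1 \<union> (pverts G2 - {v})"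
  using disjoint u v
  by (auto simp: H contract_edge_def add_edge_def graph_union_def Let_def)

lemma merge_G1: "a \<in> pverts G1 \<Longrightarrow> merge a = a"
  using v disjoint by (auto simp: merge_def)

text \<open>\<open>merge\<close> is injective on each part and the parts are loop-free, so the
  condition \<open>merge a \<noteq> merge b\<close> discards exactly the two arcs of the added
  edge.\<close>

lemma parcs_H: "parcs H = parcs G1 \<union> map_prod merge merge ` parcs G2"
proof -
  have "parcs H = {(merge a, merge b) |a b.
      (a, b) \<in> parcs G1 \<union> parcs G2 \<union> {(u, v), (v, u)} \<and> merge a \<noteq> merge b}"
    by (simp add: H contract_edge_def add_edge_def graph_union_def Let_def merge_def[abs_def])
  also have "\<dots> = parcs G1 \<union> map_prod merge merge ` parcs G2" (is "?L = ?R")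
  proof (intro equalityI subsetI)
    fix e assume "e \<in> ?L"
    then obtain a b where e: "e = (merge a, merge b)" "merge a \<noteq> merge b"
      and ab: "(a, b) \<in> parcs G1 \<union> parcs G2 \<union> {(u, v), (v, u)}" by auto
    have "merge u = u" "merge v = u" by (auto simp: merge_def)
    with e ab have "(a, b) \<in> parcs G1 \<or> (a, b) \<in> parcs G2" by auto
    then show "e \<in> ?R"
    proof
      assume "(a, b) \<in> parcs G1"
      then show ?thesis
        using e merge_G1 G1.wellformed' by fastforce
    next
      assume "(a, b) \<in> parcs G2"
      then show ?thesis using e by force
    qed
  next
    fix e assume "e \<in> ?R"
    then consider "e \<in> parcs G1"
      | a b where "e = (merge a, merge b)" "(a, b) \<in> parcs G2" by auto
    then show "e \<in> ?L"
    proof cases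
      case 1
      then obtain a b where "e = (a, b)" "(a, b) \<in> parcs G1" by (cases e) auto
      moreover from this have "merge a = a" "merge b = b" "a \<noteq> b"
        using merge_G1 G1.wellformed' G1.no_loops' by blast+
      ultimately show ?thesis by force
    next
      case 2
      then have "merge a \<noteq> merge b"
        using G2.no_loops'[of a b] G2.wellformed'[of a b] u disjoint
        by (auto simp: merge_def split: if_splits)
      with 2 show ?thesis by blast
    qed
  qed
  finally show ?thesis .
qed

lemma merge_in_H: "a \<in> pverts G2 \<Longrightarrow> merge a \<in> pverts H"
  using u by (auto simp: merge_def pverts_H)

lemma wf_H: "pair_wf_digraph H"
proof
  fix e assume "e \<in> parcs H"
  then consider "e \<in> parcs G1"
    | a b where "e = (merge a, merge b)" "(a, b) \<in> parcs G2" by (auto simp: parcs_H)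
  then have "fst e \<in> pverts H \<and> snd e \<in> pverts H"
  proof cases
    case 1
    then show ?thesis by (cases e) (auto simp: pverts_H dest: G1.wellformed')
  next
    case 2
    then show ?thesis using G2.wellformed' by (auto intro: merge_in_H)
  qed
  then show "fst e \<in> pverts H" "snd e \<in> pverts H" by auto
qed

lemma retr1_in: "retr1 a \<in> pverts G1"
  using u by (auto simp: retr1_def)

lemma retr2_in: "a \<in> pverts H \<Longrightarrow> retr2 a \<in> pverts G2"
  using v by (auto simp: retr2_def pverts_H)

lemma retr_merge:
  assumes "a \<in> pverts G2"
  shows "retr1 (merge a) = u" "retr2 (merge a) = a"
  using assms u v disjoint by (auto simp: retr1_def retr2_def merge_def)

lemma relpow_G1: "(a, b) \<in> parcs G1 ^^ n \<Longrightarrow> (a, b) \<in> parcs H ^^ n"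
proof (induction n arbitrary: b)
  case (Suc n)
  then obtain c where "(a, c) \<in> parcs G1 ^^ n" "(c, b) \<in> parcs G1" by auto
  then show ?case using Suc.IH[of c] by (auto simp: parcs_H)
qed auto

lemma relpow_G2: "(a, b) \<in> parcs G2 ^^ n \<Longrightarrow> (merge a, merge b) \<in> parcs H ^^ n"
proof (induction n arbitrary: b)
  case (Suc n)
  then obtain c where "(a, c) \<in> parcs G2 ^^ n" "(c, b) \<in> parcs G2" by auto
  then show ?case using Suc.IH[of c] by (auto simp: parcs_H)
qed auto

section \<open>Distances in the coalescence\<close>

definition dist_H :: "'a \<Rightarrow> 'a \<Rightarrow> real" where
  "dist_H a b = graph_dist G1 (retr1 a) (retr1 b) + graph_dist G2 (retr2 a) (retr2 b)"

text \<open>Every arc of \<open>H\<close> comes from one part, and the retraction onto the other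
  part is constant along it, so only one summand changes.\<close>

lemma dist_H_step:
  assumes "a \<in> pverts H" "(b, c) \<in> parcs H"
  shows "dist_H a c \<le> dist_H a b + 1"
  using assms(2) unfolding parcs_H
proof
  assume bc: "(b, c) \<in> parcs G1"
  then have "b \<in> pverts G1" "c \<in> pverts G1" using G1.wellformed' by blast+
  then show ?thesis
    using G1.graph_dist_step[OF retr1_in bc, of a] by (simp add: dist_H_def retr1_def retr2_def)
next
  assume "(b, c) \<in> map_prod merge merge ` parcs G2"
  then obtain b' c' where "b = merge b'" "c = merge c'" and bc: "(b', c') \<in> parcs G2" by auto
  moreover have "b' \<in> pverts G2" "c' \<in> pverts G2" using bc G2.wellformed' by blast+
  ultimately show ?thesis
    using G2.graph_dist_step[OF retr2_in[OF assms(1)] bc] by (simp add: dist_H_def retr_merge)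
qed

lemma dist_H_le_relpow:
  assumes "a \<in> pverts H"
  shows "(a, b) \<in> parcs H ^^ n \<Longrightarrow> dist_H a b \<le> real n"
proof (induction n arbitrary: b)
  case 0
  then show ?case
    using retr1_in[of a] retr2_in[OF assms] by (simp add: dist_H_def)
next
  case (Suc n)
  then obtain c where "(a, c) \<in> parcs H ^^ n" "(c, b) \<in> parcs H" by auto
  then show ?case
    using Suc.IH[of c] dist_H_step[OF assms, of c b] by simp
qed

text \<open>Shortest walks in the two parts are carried into \<open>H\<close> and joined at the
  merged vertex; if both ends lie in the same part, one of the walks is empty.\<close>

lemma dist_H_attained:
  assumes a: "a \<in> pverts H" and b: "b \<in> pverts H"
  shows "\<exists>n. (a, b) \<in> parcs H ^^ n \<and> dist_H a b = real n"
proof -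
  obtain k where k: "(retr1 a, retr1 b) \<in> parcs G1 ^^ k"
    "graph_dist G1 (retr1 a) (retr1 b) = real k"
    using G1.graph_dist_attained retr1_in by metis
  obtain l where l: "(retr2 a, retr2 b) \<in> parcs G2 ^^ l"
    "graph_dist G2 (retr2 a) (retr2 b) = real l"
    using G2.graph_dist_attained retr2_in a b by metis
  have l0: "l = 0" if "a \<in> pverts G1" "b \<in> pverts G1"
    using that l(2) v by (simp add: retr2_def)
  have k0: "k = 0" if "a \<notin> pverts G1" "b \<notin> pverts G1"
    using that k(2) u by (simp add: retr1_def)
  note k' = relpow_G1[OF k(1)] and l' = relpow_G2[OF l(1)]
  have m: "merge (retr2 x) = (if x \<in> pverts G1 then u else x)" if "x \<in> pverts H" for x
    using that by (auto simp: retr2_def merge_def pverts_H)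
  have "(a, b) \<in> parcs H ^^ (k + l)"
  \<comment> \<open>The part containing \<open>a\<close> is traversed first. The intermediate vertex
    is \<open>u\<close> if \<open>b\<close> lies on the other side, and \<open>b\<close> itself
    otherwise.\<close>
  proof (cases "a \<in> pverts G1")
    case True
    then have "(a, retr1 b) \<in> parcs H ^^ k" "(retr1 b, b) \<in> parcs H ^^ l"
      using k' l' l0 unfolding m[OF a] m[OF b] by (auto simp: retr1_def split: if_splits)
    then show ?thesis by (auto simp: relpow_add)
  next
    case False
    then have "(a, merge (retr2 b)) \<in> parcs H ^^ l" "(merge (retr2 b), b) \<in> parcs H ^^ k"
      using k' l' k0 unfolding m[OF a] m[OF b] by (auto simp: retr1_def split: if_splits)
    then show ?thesis by (subst add.commute) (auto simp: relpow_add)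
  qed
  then show ?thesis
    using k(2) l(2) by (intro exI[of _ "k + l"]) (simp add: dist_H_def)
qed

lemma graph_dist_H:
  assumes "a \<in> pverts H" and "b \<in> pverts H"
  shows "graph_dist H a b = dist_H a b"
proof -
  interpret H: pair_wf_digraph H by (rule wf_H)
  obtain n where n: "(a, b) \<in> parcs H ^^ n" "dist_H a b = real n"
    using dist_H_attained[OF assms] by blast
  have "n \<le> k" if "(a, b) \<in> parcs H ^^ k" for k
    using dist_H_le_relpow[OF assms(1) that] n(2) by simp
  then show ?thesis
    using H.graph_dist_eqI[OF assms(1) n(1)] n(2) by simp
qed

end

section \<open>Solvability as the absence of a kernel vector\<close>

text \<open>Replaces vectors indexed by positions with functions on vertices, so that the numbering
  \<open>vs\<close> disappears from the rest of the argument.\<close>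

lemma has_solution_iff:
  assumes "distinct vs"
  shows "has_solution (distance_matrix G vs) (all_ones_vec (length vs)) \<longleftrightarrow>
    (\<exists>x. \<forall>a\<in>set vs. (\<Sum>b\<in>set vs. graph_dist G a b * x b) = 1)"
proof -
  let ?n = "length vs"
  have dims: "dim_row (distance_matrix G vs) = ?n" "dim_col (distance_matrix G vs) = ?n"
    "dim_vec (all_ones_vec ?n) = ?n"
    by (simp_all add: distance_matrix_def all_ones_vec_def)
  have eq: "distance_matrix G vs *\<^sub>v vec ?n (\<lambda>i. x (vs ! i)) = all_ones_vec ?n \<longleftrightarrow>
      (\<forall>a\<in>set vs. (\<Sum>b\<in>set vs. graph_dist G a b * x b) = 1)" for x :: "'a \<Rightarrow> real"
  proof -
    have entry: "(distance_matrix G vs *\<^sub>v vec ?n (\<lambda>i. x (vs ! i))) $ i =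
        (\<Sum>b\<in>set vs. graph_dist G (vs ! i) b * x b)" if "i < ?n" for i
    proof -
      have "(distance_matrix G vs *\<^sub>v vec ?n (\<lambda>i. x (vs ! i))) $ i =
          (\<Sum>j<?n. graph_dist G (vs ! i) (vs ! j) * x (vs ! j))"
        using that by (simp add: distance_matrix_def scalar_prod_def lessThan_atLeast0)
      also have "\<dots> = (\<Sum>b\<in>set vs. graph_dist G (vs ! i) b * x b)"
        by (rule sum.reindex_bij_betw[OF bij_betw_nth[OF assms refl refl]])
      finally show ?thesis .
    qed
    have "distance_matrix G vs *\<^sub>v vec ?n (\<lambda>i. x (vs ! i)) = all_ones_vec ?n \<longleftrightarrow>
        (\<forall>i<?n. (distance_matrix G vs *\<^sub>v vec ?n (\<lambda>i. x (vs ! i))) $ i = all_ones_vec ?n $ i)"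
      using dims by (auto simp del: index_mult_mat_vec intro!: eq_vecI)
    also have "\<dots> \<longleftrightarrow> (\<forall>i<?n. (\<Sum>b\<in>set vs. graph_dist G (vs ! i) b * x b) = 1)"
      by (simp add: entry all_ones_vec_def)
    finally show ?thesis
      by (simp only: all_set_conv_all_nth)
  qed
  \<comment> \<open>Distinctness makes indexing invertible, so every vector arises from a function
    on vertices.\<close>
  have vec: "\<exists>x. w = vec ?n (\<lambda>i. x (vs ! i))" if "w \<in> carrier_vec ?n" for w :: "real vec"
  proof
    have "inj_on ((!) vs) {..<?n}"
      using assms by (simp add: inj_on_nth)
    then show "w = vec ?n (\<lambda>i. (\<lambda>a. w $ inv_into {..<?n} ((!) vs) a) (vs ! i))"
      using that by (intro eq_vecI) (auto simp: inv_into_f_f)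
  qed
  have "has_solution (distance_matrix G vs) (all_ones_vec ?n) \<longleftrightarrow>
      (\<exists>x. distance_matrix G vs *\<^sub>v vec ?n (\<lambda>i. x (vs ! i)) = all_ones_vec ?n)"
    unfolding has_solution_def dims by (metis vec vec_carrier)
  then show ?thesis
    by (simp only: eq)
qed

text \<open>A linear functional vanishing on the common kernel of finitely many others is a linear
  combination of them; induction on the set of functionals.\<close>

lemma functional_in_span:
  fixes A :: "'i \<Rightarrow> 'j \<Rightarrow> real" and b :: "'j \<Rightarrow> real"
  assumes "finite I" and J: "finite J"
    and "\<And>z. (\<forall>i\<in>I. (\<Sum>j\<in>J. A i j * z j) = 0) \<Longrightarrow> (\<Sum>j\<in>J. b j * z j) = 0"
  shows "\<exists>c. \<forall>j\<in>J. b j = (\<Sum>i\<in>I. c i * A i j)"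
  using assms(1,3)
proof (induction I arbitrary: b)
  case empty
  have "b k = 0" if "k \<in> J" for k
    \<comment> \<open>With no constraints \<open>b\<close> vanishes everywhere, in particular at the
      unit vectors.\<close>
    using empty[of "\<lambda>j. if j = k then 1 else 0"] that J by (simp add: if_distrib cong: if_cong)
  then show ?case by simp
next
  case (insert r I)
  have ext: "(\<Sum>i\<in>insert r I. (c(r := t)) i * A i j) = t * A r j + (\<Sum>i\<in>I. c i * A i j)" for c t j
    using insert.hyps by (auto intro!: sum.cong)
  show ?case
  \<comment> \<open>If row \<open>r\<close> vanishes on the common kernel of \<open>I\<close>, it
    adds no constraint and gets coefficient 0.\<close>
  proof (cases "\<exists>w. (\<forall>i\<in>I. (\<Sum>j\<in>J. A i j * w j) = 0) \<and> (\<Sum>j\<in>J. A r j * w j) \<noteq> 0")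
    case False
    then have "\<exists>c. \<forall>j\<in>J. b j = (\<Sum>i\<in>I. c i * A i j)"
      by (intro insert.IH insert.prems) auto
    then obtain c where "\<forall>j\<in>J. b j = (\<Sum>i\<in>I. c i * A i j)" by blast
    then show ?thesis
      using ext[of c 0] by (intro exI[of _ "c(r := 0)"]) simp
  next
    case True
    then obtain w where w: "\<And>i. i \<in> I \<Longrightarrow> (\<Sum>j\<in>J. A i j * w j) = 0"
      and r: "(\<Sum>j\<in>J. A r j * w j) \<noteq> 0" by blast
    \<comment> \<open>\<open>b - t * A r\<close> vanishes at \<open>w\<close>, hence on the whole common kernel of the rows in \<open>I\<close>.\<close>
    define t where "t = (\<Sum>j\<in>J. b j * w j) / (\<Sum>j\<in>J. A r j * w j)"
    have "\<exists>c. \<forall>j\<in>J. b j - t * A r j = (\<Sum>i\<in>I. c i * A i j)"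
    proof (rule insert.IH)
      fix z assume z: "\<forall>i\<in>I. (\<Sum>j\<in>J. A i j * z j) = 0"
      \<comment> \<open>Chosen so that \<open>z - s * w\<close> is annihilated by row
        \<open>r\<close> too, which makes the hypothesis on \<open>b\<close> applicable to
        it.\<close>
      define s where "s = (\<Sum>j\<in>J. A r j * z j) / (\<Sum>j\<in>J. A r j * w j)"
      have lin: "(\<Sum>j\<in>J. f j * (z j - s * w j)) = (\<Sum>j\<in>J. f j * z j) - s * (\<Sum>j\<in>J. f j * w j)"
        for f :: "'j \<Rightarrow> real"
        by (simp add: algebra_simps sum_subtractf sum_distrib_left)
      have "(\<Sum>j\<in>J. b j * (z j - s * w j)) = 0"
      proof (rule insert.prems, intro ballI)
        fix i assume "i \<in> insert r I"
        then show "(\<Sum>j\<in>J. A i j * (z j - s * w j)) = 0"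
          unfolding lin using z w r by (auto simp: s_def)
      qed
      then have "(\<Sum>j\<in>J. b j * z j) = t * (\<Sum>j\<in>J. A r j * z j)"
        unfolding lin using r by (simp add: s_def t_def field_simps)
      then show "(\<Sum>j\<in>J. (b j - t * A r j) * z j) = 0"
        by (simp add: algebra_simps sum_subtractf sum_distrib_left)
    qed
    then obtain c where "\<forall>j\<in>J. b j - t * A r j = (\<Sum>i\<in>I. c i * A i j)" by blast
    then show ?thesis
      using ext[of c t] by (intro exI[of _ "c(r := t)"]) (simp add: algebra_simps)
  qed
qed

text \<open>The Fredholm alternative for the right-hand side \<open>\<one>\<close>, with the kernel
  vector scaled to entry sum 1; symmetry identifies left and right kernels.\<close>

lemma symmetric_solvable_iff:
  fixes d :: "'a \<Rightarrow> 'a \<Rightarrow> real"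
  assumes "finite V" and sym: "\<And>a b. a \<in> V \<Longrightarrow> b \<in> V \<Longrightarrow> d a b = d b a"
  shows "(\<exists>x. \<forall>a\<in>V. (\<Sum>b\<in>V. d a b * x b) = 1) \<longleftrightarrow>
    \<not> (\<exists>z. (\<forall>a\<in>V. (\<Sum>b\<in>V. d a b * z b) = 0) \<and> (\<Sum>b\<in>V. z b) = 1)"
proof (intro iffI notI)
  assume "\<exists>x. \<forall>a\<in>V. (\<Sum>b\<in>V. d a b * x b) = 1"
    and "\<exists>z. (\<forall>a\<in>V. (\<Sum>b\<in>V. d a b * z b) = 0) \<and> (\<Sum>b\<in>V. z b) = 1"
  then obtain x z where x: "\<And>a. a \<in> V \<Longrightarrow> (\<Sum>b\<in>V. d a b * x b) = 1"
    and z: "\<And>a. a \<in> V \<Longrightarrow> (\<Sum>b\<in>V. d a b * z b) = 0" "(\<Sum>b\<in>V. z b) = 1" by auto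
  \<comment> \<open>The bilinear form of \<open>d\<close> at \<open>z\<close> and \<open>x\<close>
    is evaluated in two ways, giving both 1 and 0.\<close>
  have "(\<Sum>a\<in>V. z a) = (\<Sum>a\<in>V. \<Sum>b\<in>V. z a * (d a b * x b))"
    by (simp add: x flip: sum_distrib_left)
  also have "\<dots> = (\<Sum>b\<in>V. \<Sum>a\<in>V. z a * (d a b * x b))"
    by (rule sum.swap)
  also have "\<dots> = (\<Sum>b\<in>V. x b * (\<Sum>a\<in>V. d b a * z a))"
    by (auto simp: sum_distrib_left sym intro!: sum.cong)
  also have "\<dots> = 0"
    by (simp add: z)
  finally show False
    using z by simp
next
  assume no: "\<not> (\<exists>z. (\<forall>a\<in>V. (\<Sum>b\<in>V. d a b * z b) = 0) \<and> (\<Sum>b\<in>V. z b) = 1)"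
  have "(\<Sum>b\<in>V. 1 * z b) = 0" if z: "\<forall>a\<in>V. (\<Sum>b\<in>V. d a b * z b) = 0" for z
  proof (rule ccontr)
    assume ne: "(\<Sum>b\<in>V. 1 * z b) \<noteq> 0"
    let ?z = "\<lambda>b. z b / (\<Sum>b\<in>V. z b)"
    have "\<forall>a\<in>V. (\<Sum>b\<in>V. d a b * ?z b) = 0" "(\<Sum>b\<in>V. ?z b) = 1"
      using z ne by (simp_all flip: sum_divide_distrib)
    then show False
      using no by (auto dest!: spec[of _ ?z])
  qed
  from functional_in_span[OF assms(1) assms(1), of d "\<lambda>_. 1", OF this]
  obtain c where c: "\<forall>j\<in>V. 1 = (\<Sum>i\<in>V. c i * d i j)" by auto
  have "(\<Sum>b\<in>V. d a b * c b) = (\<Sum>b\<in>V. c b * d b a)" if "a \<in> V" for a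
    using that sym by (auto intro!: sum.cong)
  with c show "\<exists>x. \<forall>a\<in>V. (\<Sum>b\<in>V. d a b * x b) = 1"
    by (intro exI[of _ c]) simp
qed

section \<open>The kernel vector of the coalescence\<close>

context coalescence
begin

text \<open>The merged vertex is counted twice, as \<open>u\<close> and as
  \<open>merge v\<close>.\<close>

lemma sum_pverts_H:
  fixes f :: "'a \<Rightarrow> real"
  shows "(\<Sum>b\<in>pverts H. f b) = (\<Sum>b\<in>pverts G1. f b) + (\<Sum>b\<in>pverts G2. f (merge b)) - f u"
proof -
  have "(\<Sum>b\<in>pverts G2. f (merge b)) = f u + (\<Sum>b\<in>pverts G2 - {v}. f b)"
    using sum.remove[OF G2.pair_finite_verts v, of "f \<circ> merge"]
    by (simp add: merge_def)
  moreover have "(\<Sum>b\<in>pverts H. f b) = (\<Sum>b\<in>pverts G1. f b) + (\<Sum>b\<in>pverts G2 - {v}. f b)"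
    unfolding pverts_H using G1.pair_finite_verts G2.pair_finite_verts disjoint
    by (intro sum.union_disjoint) auto
  ultimately show ?thesis by simp
qed

lemma kernel_vector_H:
  assumes z1: "\<And>a. a \<in> pverts G1 \<Longrightarrow> (\<Sum>b\<in>pverts G1. graph_dist G1 a b * z1 b) = 0"
    "(\<Sum>b\<in>pverts G1. z1 b) = 1"
    and z2: "\<And>a. a \<in> pverts G2 \<Longrightarrow> (\<Sum>b\<in>pverts G2. graph_dist G2 a b * z2 b) = 0"
    "(\<Sum>b\<in>pverts G2. z2 b) = 1"
  shows "\<exists>z. (\<forall>a\<in>pverts H. (\<Sum>b\<in>pverts H. dist_H a b * z b) = 0) \<and> (\<Sum>b\<in>pverts H. z b) = 1"
proof -
  \<comment> \<open>At \<open>u\<close> the first summand gives only \<open>z1 u\<close>; the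
    correction adds the entry of \<open>z2\<close> at \<open>v\<close> and subtracts the unit
    vector.\<close>
  let ?z = "\<lambda>b. (if b \<in> pverts G1 then z1 b else z2 b) + (if b = u then z2 v - 1 else 0)"
  \<comment> \<open>Used with \<open>f = dist_H a\<close> for the kernel equation and with
    \<open>f = 1\<close> for the entry sum.\<close>
  have main: "(\<Sum>b\<in>pverts H. f b * ?z b) =
      (\<Sum>b\<in>pverts G1. f b * z1 b) + (\<Sum>b\<in>pverts G2. f (merge b) * z2 b) - f u"
    for f :: "'a \<Rightarrow> real"
  proof -
    have "(\<Sum>b\<in>pverts G1. f b * ?z b) =
        (\<Sum>b\<in>pverts G1. f b * z1 b + (if b = u then f u * (z2 v - 1) else 0))"
      by (intro sum.cong) (auto simp: algebra_simps)
    moreover have "(\<Sum>b\<in>pverts G2. f (merge b) * ?z (merge b)) =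
        (\<Sum>b\<in>pverts G2. f (merge b) * z2 b + (if b = v then f u * (z1 u - 1) else 0))"
      using u disjoint by (intro sum.cong) (auto simp: merge_def algebra_simps)
    ultimately show ?thesis
      using u v G1.pair_finite_verts G2.pair_finite_verts
      by (simp add: sum_pverts_H sum.distrib algebra_simps)
  qed
  have "(\<Sum>b\<in>pverts H. dist_H a b * ?z b) = 0" if a: "a \<in> pverts H" for a
  proof -
    note r = retr1_in[of a] retr2_in[OF a]
    \<comment> \<open>On \<open>G1\<close> the second summand of \<open>dist_H a b\<close> is
      constant in \<open>b\<close>: it survives because \<open>z1\<close> sums to 1, while the first
      is killed by the kernel equation.\<close>
    have "(\<Sum>b\<in>pverts G1. dist_H a b * z1 b) = graph_dist G2 (retr2 a) v"
    proof -
      have "(\<Sum>b\<in>pverts G1. dist_H a b * z1 b) =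
          (\<Sum>b\<in>pverts G1. graph_dist G1 (retr1 a) b * z1 b + graph_dist G2 (retr2 a) v * z1 b)"
        by (intro sum.cong) (auto simp: dist_H_def retr1_def retr2_def algebra_simps)
      then show ?thesis
        using z1 r by (simp add: sum.distrib flip: sum_distrib_left)
    qed
    moreover have "(\<Sum>b\<in>pverts G2. dist_H a (merge b) * z2 b) = graph_dist G1 (retr1 a) u"
    proof -
      have "(\<Sum>b\<in>pverts G2. dist_H a (merge b) * z2 b) =
          (\<Sum>b\<in>pverts G2. graph_dist G1 (retr1 a) u * z2 b + graph_dist G2 (retr2 a) b * z2 b)"
        by (intro sum.cong) (auto simp: dist_H_def retr_merge algebra_simps)
      then show ?thesis
        using z2 r by (simp add: sum.distrib flip: sum_distrib_left)
    qed
    \<comment> \<open>The two contributions add up to exactly the term that the subtracted unit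
      vector at \<open>u\<close> removes.\<close>
    moreover have "dist_H a u = graph_dist G1 (retr1 a) u + graph_dist G2 (retr2 a) v"
      using u by (simp add: dist_H_def retr1_def retr2_def)
    ultimately show ?thesis
      unfolding main by simp
  qed
  moreover have "(\<Sum>b\<in>pverts H. ?z b) = 1"
    using main[of "\<lambda>_. 1"] z1(2) z2(2) by simp
  ultimately show ?thesis by (intro exI[of _ ?z]) blast
qed

end

theorem theorem6:
  fixes G1 G2 H :: "'a pair_pre_digraph"
    and u v :: 'a
    and vs1 vs2 vsH :: "'a list"
  assumes "pair_graph G1" and "Digraph_Component.connected (with_proj G1)"
    and "pair_graph G2" and "Digraph_Component.connected (with_proj G2)"
    and "pverts G1 \<inter> pverts G2 = {}"
    and "distinct vs1" and "set vs1 = pverts G1"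
    and "distinct vs2" and "set vs2 = pverts G2"
    and "\<not> has_solution (distance_matrix G1 vs1) (all_ones_vec (length vs1))"
    and "\<not> has_solution (distance_matrix G2 vs2) (all_ones_vec (length vs2))"
    and "u \<in> pverts G1" and "v \<in> pverts G2"
    and "H = contract_edge u v (add_edge u v (graph_union G1 G2))"
    and "distinct vsH" and "set vsH = pverts H"
  shows "\<not> has_solution (distance_matrix H vsH) (all_ones_vec (length vsH))"
proof -
  interpret coalescence G1 G2 u v H
    using assms by (intro coalescence.intro connected_pair_graph.intro
        coalescence_axioms.intro connected_pair_graph_axioms.intro)
  obtain z1 where z1: "\<And>a. a \<in> pverts G1 \<Longrightarrow> (\<Sum>b\<in>pverts G1. graph_dist G1 a b * z1 b) = 0"
    "(\<Sum>b\<in>pverts G1. z1 b) = 1"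
    using assms(10)
      symmetric_solvable_iff[of _ "graph_dist G1", OF G1.pair_finite_verts G1.graph_dist_sym]
    by (auto simp: has_solution_iff[OF assms(6)] assms(7))
  obtain z2 where z2: "\<And>a. a \<in> pverts G2 \<Longrightarrow> (\<Sum>b\<in>pverts G2. graph_dist G2 a b * z2 b) = 0"
    "(\<Sum>b\<in>pverts G2. z2 b) = 1"
    using assms(11)
      symmetric_solvable_iff[of _ "graph_dist G2", OF G2.pair_finite_verts G2.graph_dist_sym]
    by (auto simp: has_solution_iff[OF assms(8)] assms(9))
  \<comment> \<open>The alternative is applied to \<open>dist_H\<close>, whose symmetry is inherited
    from the parts; \<open>graph_dist_H\<close> then transfers the result to the distance matrix of
    \<open>H\<close>.\<close>
  have sym: "dist_H a b = dist_H b a" if "a \<in> pverts H" "b \<in> pverts H" for a b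
    using that unfolding dist_H_def
    by (metis G1.graph_dist_sym G2.graph_dist_sym retr1_in retr2_in)
  have fin: "finite (pverts H)"
    using assms(16) by (metis List.finite_set)
  have "\<not> (\<exists>x. \<forall>a\<in>pverts H. (\<Sum>b\<in>pverts H. dist_H a b * x b) = 1)"
    using symmetric_solvable_iff[of _ dist_H, OF fin sym] kernel_vector_H[OF z1 z2] by simp
  then show ?thesis
    by (simp add: has_solution_iff[OF assms(15)] assms(16) graph_dist_H cong: sum.cong)
qed

end
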